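(* Let $n\ge 2$, let $\{x_1,\dots,x_n\}\subset\mathbb{R}^2$ be a cluster of $n$ particles and let $x_{n+1}$ be the next particle added by Gradient Flow Aggregation with $\alpha=\infty$. Then $x_{n+1}$ can only attach to particles lying on the boundary of the convex hull of $\{x_1,\dots,x_n\}$. Moreover, if $x_k$ is a particle on the boundary of the convex hull with interior opening angle $\theta$, then $$\mathbb{P}\left(x_{n+1}\text{ attaches itself to }x_k\right)=\frac{\pi-\theta}{2\pi}.$$
   Context: Cluster: particles are disks of radius $1/2$ identified with their centers. A cluster of $n$ particles is a set $\{x_1,\dots,x_n\}\subset\mathbb{R}^2$ with $x_1=0$, $\|x_i-x_j\|\ge1$ for $i\ne j$, and such that the graph joining $x_i$ and $x_j$ whenever $\|x_i-x_j\|=1$ is connected. Gradient Flow Aggregation with $\alpha=\infty$: here $E(x)=\max_{1\le i\le n}\|x-x_i\|^{-1}$. A new particle starts at a point chosen uniformly at random on the circle $\{\|x\|=r\}$ and moves in direction $\nabla E$ (defined almost everywhere), i.e. in a straight line toward the nearest point of $\{x_1,\dots,x_n\}$, until it is at distance $1$ from that point, to which it then attaches; its final position is $x_{n+1}$. The probability that $x_{n+1}$ attaches itself to $x_k$ is the limit as $r\to\infty$ of the probability that the particle started uniformly on $\{\|x\|=r\}$ attaches to $x_k$, and "can only attach" refers to starting points at sufficiently large distance $r$. The interior opening angle at a point $x_k$ of the boundary of the convex hull is the angle of the convex hull at $x_k$ (the angle between the two boundary edges meeting at $x_k$, measured inside the hull); it equals $\pi$ if $x_k$ lies in the relative interior of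 a boundary edge of a non-degenerate hull. If all points are collinear, it is $0$ at the two extreme points and $\pi$ at the other points. *)

theory Defs
  imports "HOL-Analysis.Analysis"
begin

definition touching :: "nat \<Rightarrow> (nat \<Rightarrow> real^2) \<Rightarrow> (nat \<times> nat) set" where
  "touching n x = {(i, j). i \<in> {1..n} \<and> j \<in> {1..n} \<and> dist (x i) (x j) = 1}"

definition cluster :: "nat \<Rightarrow> (nat \<Rightarrow> real^2) \<Rightarrow> bool" where
  "cluster n x \<longleftrightarrow>
     x 1 = 0 \<and>
     (\<forall>i\<in>{1..n}. \<forall>j\<in>{1..n}. i \<noteq> j \<longrightarrow> dist (x i) (x j) \<ge> 1) \<and>
     (\<forall>i\<in>{1..n}. \<forall>j\<in>{1..n}. (i, j) \<in> (touching n x)\<^sup>*)"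

abbreviation cluster_hull :: "nat \<Rightarrow> (nat \<Rightarrow> real^2) \<Rightarrow> (real^2) set" where
  "cluster_hull n x \<equiv> convex hull (x ` {1..n})"

definition energy :: "nat \<Rightarrow> (nat \<Rightarrow> real^2) \<Rightarrow> real^2 \<Rightarrow> real" where
  "energy n x p = (MAX i\<in>{1..n}. inverse (norm (p - x i)))"

(* The particle moves at unit speed in the direction of the gradient. A path on which the
   gradient fails to exist at some time (two nearest particles) is not a trajectory. *)
definition gfa_trajectory ::
    "nat \<Rightarrow> (nat \<Rightarrow> real^2) \<Rightarrow> real \<Rightarrow> (real \<Rightarrow> real^2) \<Rightarrow> bool" where
  "gfa_trajectory n x T \<gamma> \<longleftrightarrow>
     0 \<le> T \<and>
     (\<forall>t\<in>{0..T}. \<exists>g. (GDERIV (energy n x) (\<gamma> t) :> g) \<and>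
        (\<gamma> has_vector_derivative sgn g) (at t within {0..T}))"

(* q is the final position of the particle started at p: the first point of its trajectory at
   distance 1 from some particle of the cluster. The first particle at distance 1 is
   necessarily the nearest one, i.e. the one towards which the particle moves. *)
definition new_particle :: "nat \<Rightarrow> (nat \<Rightarrow> real^2) \<Rightarrow> real^2 \<Rightarrow> real^2 \<Rightarrow> bool" where
  "new_particle n x p q \<longleftrightarrow>
     (\<exists>T \<gamma>. gfa_trajectory n x T \<gamma> \<and> \<gamma> 0 = p \<and> \<gamma> T = q \<and>
        (\<forall>t\<in>{0..<T}. \<forall>i\<in>{1..n}. dist (\<gamma> t) (x i) > 1) \<and>
        (\<exists>i\<in>{1..n}. dist q (x i) = 1))"

definition attaches :: "nat \<Rightarrow> (nat \<Rightarrow> real^2) \<Rightarrow> real^2 \<Rightarrow> nat \<Rightarrow> bool" where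
  "attaches n x p k \<longleftrightarrow> k \<in> {1..n} \<and> (\<exists>q. new_particle n x p q \<and> dist q (x k) = 1)"

definition uniform_circle :: "real \<Rightarrow> (real^2) measure" where
  "uniform_circle r =
     distr (uniform_measure lborel {0..<2 * pi}) borel (\<lambda>\<phi>. vector [r * cos \<phi>, r * sin \<phi>])"

definition angle_at :: "real^2 \<Rightarrow> real^2 \<Rightarrow> real^2 \<Rightarrow> real" where
  "angle_at a v b = arccos (((a - v) \<bullet> (b - v)) / (norm (a - v) * norm (b - v)))"

(* Interior angle of the polygon "convex hull X" at a boundary point v. The first case covers
   both the relative interior of an edge of a non-degenerate hull and the non-extreme points of
   a segment, since a non-trivial segment is an edge of itself. The second case is left with the
   two endpoints of a segment. In the last case v is a vertex of a non-degenerate polygon, where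
   exactly two edges meet; their angle measured inside is below pi, hence given by arccos. *)
definition opening_angle :: "(real^2) set \<Rightarrow> real^2 \<Rightarrow> real" where
  "opening_angle X v =
     (if \<exists>e. e edge_of (convex hull X) \<and> v \<in> rel_interior e then pi
      else if collinear X then 0
      else (THE \<theta>. \<exists>a b. a \<noteq> b \<and>
              closed_segment v a edge_of (convex hull X) \<and>
              closed_segment v b edge_of (convex hull X) \<and>
              \<theta> = angle_at a v b))"

end

theory Submission
  imports Defs
begin

text \<open>The energy is differentiable at a point exactly when that point has a unique nearest particle
  and is not itself a particle. Along a trajectory the nearest particle therefore cannot change, since
  the open cells of points with a given unique nearest particle are disjoint and the trajectory is
  connected. So a particle started far away at \<open>p\<close> attaches to \<open>x\<^sub>k\<close> iff \<open>x\<^sub>k\<close> is the unique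
  nearest particle of \<open>p\<close>. For \<open>p = r u\<close> with \<open>u\<close> a unit vector and \<open>r \<rightarrow> \<infinity>\<close>, this becomes the condition
  \<open>u \<bullet> (y - x\<^sub>k) < 0\<close> for all other particles \<open>y\<close>, i.e. \<open>u\<close> lies in the interior of the normal cone of
  the hull at \<open>x\<^sub>k\<close>. By dominated convergence the probability tends to the normalised angular size of
  that cone. At a vertex only the two adjacent edges matter, and the two open half circles they
  determine meet in an arc of length \<open>\<pi> - \<theta>\<close>.\<close>

section \<open>Trajectories\<close>

text \<open>The open Voronoi cell of \<open>x i\<close>, with \<open>x i\<close> itself removed
  because the energy has its pole there. Competitors are compared by index, so coinciding particles
  would have empty cells.\<close>

definition cell :: "nat \<Rightarrow> (nat \<Rightarrow> real^2) \<Rightarrow> nat \<Rightarrow> (real^2) set" where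
  "cell n x i = {p. p \<noteq> x i \<and> (\<forall>j\<in>{1..n}-{i}. dist p (x i) < dist p (x j))}"

lemma open_cell: "open (cell n x i)"
proof -
  have "cell n x i = - {x i} \<inter> (\<Inter>j\<in>{1..n}-{i}. {p. dist p (x i) < dist p (x j)})"
    by (auto simp: cell_def)
  moreover have "open {p. dist p (x i) < dist p (x j)}" for j
    by (intro open_Collect_less continuous_intros)
  ultimately show ?thesis by (auto intro!: open_Int open_INT)
qed

lemma cell_disjoint:
  assumes "i \<in> {1..n}" "j \<in> {1..n}" "p \<in> cell n x i" "p \<in> cell n x j"
  shows "i = j"
proof (rule ccontr)
  assume "i \<noteq> j"
  then have "dist p (x i) < dist p (x j)" "dist p (x j) < dist p (x i)"
    using assms by (auto simp: cell_def)
  then show False by simp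
qed

section \<open>Differentiability of the energy and uniqueness of the nearest particle\<close>

lemma energy_ge: "i \<in> {1..n} \<Longrightarrow> inverse (norm (p - x i)) \<le> energy n x p"
  unfolding energy_def by (intro Max_ge) auto

lemma energy_eq_nearest:
  assumes "i \<in> {1..n}" "p \<noteq> x i" "\<forall>j\<in>{1..n}. dist p (x i) \<le> dist p (x j)"
  shows "energy n x p = inverse (norm (p - x i))"
  unfolding energy_def
proof (rule Max_eqI)
  fix y assume "y \<in> (\<lambda>i. inverse (norm (p - x i))) ` {1..n}"
  then obtain j where "j \<in> {1..n}" "y = inverse (norm (p - x j))" by blast
  then show "y \<le> inverse (norm (p - x i))"
    using assms by (auto simp: dist_norm intro!: le_imp_inverse_le)
qed (use assms in auto)

lemma GDERIV_inverse_norm: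
  fixes a p :: "'a::real_inner"
  assumes "p \<noteq> a"
  shows "GDERIV (\<lambda>q. inverse (norm (q - a))) p :> - ((inverse (norm (p - a)))\<^sup>2 *\<^sub>R sgn (p - a))"
proof -
  have "((\<lambda>q. norm (q - a)) has_derivative (\<lambda>h. h \<bullet> sgn (p - a))) (at p)"
  proof (rule has_derivative_compose[where g=norm])
    show "((\<lambda>q. q - a) has_derivative (\<lambda>h. h)) (at p)"
      by (auto intro!: derivative_eq_intros)
    show "(norm has_derivative (\<lambda>h. h \<bullet> sgn (p - a))) (at (p - a))"
      using has_derivative_norm[of "p - a"] assms by simp
  qed
  then have "GDERIV (\<lambda>q. norm (q - a)) p :> sgn (p - a)"
    by (simp add: gderiv_def)
  from GDERIV_inverse[OF this] show ?thesis using assms by simp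
qed

lemma GDERIV_energy_cell:
  assumes "i \<in> {1..n}" "p \<in> cell n x i"
  shows "GDERIV (energy n x) p :> - ((inverse (norm (p - x i)))\<^sup>2 *\<^sub>R sgn (p - x i))"
proof -
  have "energy n x q = inverse (norm (q - x i))" if "q \<in> cell n x i" for q
  proof (rule energy_eq_nearest)
    show "\<forall>j\<in>{1..n}. dist q (x i) \<le> dist q (x j)"
    proof
      fix j assume "j \<in> {1..n}"
      then show "dist q (x i) \<le> dist q (x j)"
        using that by (cases "j = i") (auto simp: cell_def intro: less_imp_le)
    qed
  qed (use that assms in \<open>auto simp: cell_def\<close>)
  moreover have "p \<noteq> x i" using assms by (simp add: cell_def)
  ultimately show ?thesis
    using has_derivative_transform_within_open[OF GDERIV_inverse_norm[unfolded gderiv_def] open_cell assms(2)]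
    unfolding gderiv_def by simp
qed

text \<open>A maximum of smooth functions that is differentiable at a point has the same gradient
  there as each function attaining the maximum. The gradient of the inverse distance to a particle
  determines that particle: its length gives the distance and its direction the bearing.\<close>

lemma GDERIV_energy_imp_cell:
  assumes n: "n \<ge> 1" and inj: "inj_on x {1..n}" and g: "GDERIV (energy n x) p :> g"
  shows "\<exists>i\<in>{1..n}. p \<in> cell n x i"
proof -
  have "finite {1..n}" "{1..n} \<noteq> {}" using n by auto
  then obtain i where i: "i \<in> {1..n}" "\<forall>j\<in>{1..n}. dist p (x i) \<le> dist p (x j)"
    using arg_min_if_finite(1)[of "{1..n}" "\<lambda>j. dist p (x j)"]
      arg_min_least[of "{1..n}" _ "\<lambda>j. dist p (x j)"] by blast
  \<comment> \<open>Since \<open>inverse 0 = 0\<close>, the energy has a finite value at a particle,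
    but it tends to infinity around it. So it is discontinuous there and has no gradient.\<close>
  have ne: "p \<noteq> x i"
  proof
    assume p: "p = x i"
    have "isCont (energy n x) p"
      using g by (auto simp: gderiv_def intro: has_derivative_continuous)
    then have "(energy n x \<longlongrightarrow> energy n x p) (at p)" by (simp add: isCont_def)
    moreover have "filterlim (energy n x) at_top (at p)"
    proof (rule filterlim_at_top_mono)
      have "filterlim (\<lambda>q. norm (q - p)) (at_right 0) (at p)"
        unfolding filterlim_at
        by (auto simp: eventually_at_filter intro!: tendsto_eq_intros)
      then show "filterlim (\<lambda>q. inverse (norm (q - p))) at_top (at p)"
        by (rule filterlim_compose[OF filterlim_inverse_at_top_right])
      show "\<forall>\<^sub>F q in at p. inverse (norm (q - p)) \<le> energy n x q"
        using energy_ge[OF i(1)] p by simp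
    qed
    ultimately show False
      using not_tendsto_and_filterlim_at_infinity[of "at p" "energy n x"]
      by (metis at_neq_bot filterlim_at_top_imp_at_infinity)
  qed
  have grad: "g = - ((inverse (norm (p - x j)))\<^sup>2 *\<^sub>R sgn (p - x j))"
    if j: "j \<in> {1..n}" "dist p (x j) = dist p (x i)" for j
  proof -
    have pj: "p \<noteq> x j" using ne j by auto
    have ej: "energy n x p = inverse (norm (p - x j))"
      using energy_eq_nearest[of j n p x] i j pj by auto
    let ?g = "- ((inverse (norm (p - x j)))\<^sup>2 *\<^sub>R sgn (p - x j))"
    \<comment> \<open>The energy dominates the term of \<open>x j\<close> everywhere and equals it
      at \<open>p\<close>, so the difference has a minimum at \<open>p\<close> and its derivative
      vanishes.\<close>
    have "((\<lambda>q. energy n x q - inverse (norm (q - x j))) has_derivative (\<lambda>h. h \<bullet> g - h \<bullet> ?g)) (at p)"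
      using GDERIV_inverse_norm[OF pj] g unfolding gderiv_def by (rule has_derivative_diff[rotated])
    then have "(\<lambda>h. h \<bullet> g - h \<bullet> ?g) = (\<lambda>h. 0)"
      by (rule differential_zero_maxmin[where S=UNIV, rotated 2])
        (use energy_ge[OF j(1)] ej in auto)
    \<comment> \<open>The vanishing functional is evaluated at \<open>h = g - ?g\<close>.\<close>
    then have "(g - ?g) \<bullet> g - (g - ?g) \<bullet> ?g = 0" by meson
    then have "(g - ?g) \<bullet> (g - ?g) = 0" by (simp only: inner_diff_right)
    then have "g - ?g = 0" by (simp only: inner_eq_zero_iff)
    then show ?thesis by (simp only: right_minus_eq)
  qed
  have "dist p (x i) < dist p (x j)" if j: "j \<in> {1..n}" "j \<noteq> i" for j
  proof (rule ccontr)
    assume "\<not> ?thesis"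
    then have e: "dist p (x j) = dist p (x i)" using i j by force
    then have nn: "norm (p - x j) = norm (p - x i)" by (simp add: dist_norm)
    have "- ((inverse (norm (p - x i)))\<^sup>2 *\<^sub>R sgn (p - x i)) =
        - ((inverse (norm (p - x i)))\<^sup>2 *\<^sub>R sgn (p - x j))"
      by (rule trans[OF grad[OF i(1) refl, symmetric] grad[OF j(1) e, unfolded nn]])
    then have "sgn (p - x i) = sgn (p - x j)"
      by (simp only: neg_equal_iff_equal scaleR_cancel_left) (use ne in auto)
    then have "p - x i = p - x j" using nn ne by (simp add: sgn_div_norm)
    then have "x i = x j" by simp
    then show False using inj_onD[OF inj] i(1) j by blast
  qed
  then have "p \<in> cell n x i" using ne by (simp add: cell_def)
  then show ?thesis using i by blast
qed

section \<open>Trajectories inside a cell and the attachment rule\<close>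

lemma sgn_energy_gradient:
  assumes "p \<in> cell n x i"
  shows "sgn (- ((inverse (norm (p - x i)))\<^sup>2 *\<^sub>R sgn (p - x i))) = - sgn (p - x i)"
proof -
  have "p \<noteq> x i" using assms by (simp add: cell_def)
  then have "norm (sgn (p - x i)) = 1" by (simp add: norm_sgn)
  then have "sgn (sgn (p - x i)) = sgn (p - x i)" by (simp add: sgn_div_norm[of "sgn _"])
  then show ?thesis using \<open>p \<noteq> x i\<close> by (simp add: sgn_minus sgn_scaleR)
qed

text \<open>Moving straight towards \<open>x k\<close> by \<open>t\<close> lowers the distance to
  \<open>x k\<close> by exactly \<open>t\<close> and the distance to any other particle by at most
  \<open>t\<close>. So \<open>x k\<close> stays the unique nearest particle, the gradient keeps its
  direction, and the straight path is a trajectory until contact.\<close>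

lemma straight_trajectory:
  assumes k: "k \<in> {1..n}" and p: "p \<in> cell n x k" and d: "dist p (x k) > 1"
  defines "\<gamma> \<equiv> \<lambda>t. p - t *\<^sub>R sgn (p - x k)"
  shows "gfa_trajectory n x (dist p (x k) - 1) \<gamma>" "dist (\<gamma> (dist p (x k) - 1)) (x k) = 1"
    "\<And>t. 0 \<le> t \<Longrightarrow> t \<le> dist p (x k) - 1 \<Longrightarrow> dist (\<gamma> t) (x k) = dist p (x k) - t"
    "\<And>t. 0 \<le> t \<Longrightarrow> t \<le> dist p (x k) - 1 \<Longrightarrow> \<gamma> t \<in> cell n x k"
proof -
  define D where "D = dist p (x k)"
  have D: "D = norm (p - x k)" by (simp add: D_def dist_norm)
  have ne: "p \<noteq> x k" using p by (simp add: cell_def)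
  have D1: "D > 1" using d by (simp add: D_def)
  have pk: "p - x k = D *\<^sub>R sgn (p - x k)" using ne by (simp add: D sgn_div_norm)
  have n1: "norm (sgn (p - x k)) = 1" using ne by (simp add: norm_sgn)
  have gk: "\<gamma> t - x k = (D - t) *\<^sub>R sgn (p - x k)" for t
    using pk by (simp add: \<gamma>_def algebra_simps)
  show dt: "dist (\<gamma> t) (x k) = dist p (x k) - t" if "0 \<le> t" "t \<le> dist p (x k) - 1" for t
    using that gk[of t] n1 by (simp add: dist_norm[of "\<gamma> t"] D_def[symmetric])
  then show "dist (\<gamma> (dist p (x k) - 1)) (x k) = 1" using D1 by (simp add: D_def)
  show cell: "\<gamma> t \<in> cell n x k" if t: "0 \<le> t" "t \<le> dist p (x k) - 1" for t
  proof -
    have "dist (\<gamma> t) (x k) < dist (\<gamma> t) (x j)" if "j \<in> {1..n} - {k}" for j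
    proof -
      have "dist p (x j) \<le> dist p (\<gamma> t) + dist (\<gamma> t) (x j)" by (rule dist_triangle)
      moreover have "dist p (\<gamma> t) = t" using n1 t by (simp add: dist_norm \<gamma>_def)
      moreover have "dist p (x k) < dist p (x j)" using p that by (auto simp: cell_def)
      ultimately show ?thesis using dt[OF t] by simp
    qed
    moreover have "\<gamma> t \<noteq> x k" using dt[OF t] t by force
    ultimately show ?thesis by (auto simp: cell_def)
  qed
  show "gfa_trajectory n x (dist p (x k) - 1) \<gamma>"
    unfolding gfa_trajectory_def
  proof (intro conjI ballI exI)
    show "0 \<le> dist p (x k) - 1" using d by simp
    fix t assume "t \<in> {0..dist p (x k) - 1}"
    then have t: "0 \<le> t" "t \<le> dist p (x k) - 1" by auto
    from GDERIV_energy_cell[OF k cell[OF t]]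
    show "GDERIV (energy n x) (\<gamma> t) :> - ((inverse (norm (\<gamma> t - x k)))\<^sup>2 *\<^sub>R sgn (\<gamma> t - x k))" .
    have "sgn (\<gamma> t - x k) = sgn (p - x k)"
      using t gk[of t] n1 by (simp add: sgn_scaleR D_def sgn_div_norm[of "sgn _"])
    then have s: "sgn (- ((inverse (norm (\<gamma> t - x k)))\<^sup>2 *\<^sub>R sgn (\<gamma> t - x k))) = - sgn (p - x k)"
      using sgn_energy_gradient[OF cell[OF t]] by simp
    show "(\<gamma> has_vector_derivative sgn (- ((inverse (norm (\<gamma> t - x k)))\<^sup>2 *\<^sub>R sgn (\<gamma> t - x k))))
        (at t within {0..dist p (x k) - 1})"
      unfolding s by (auto simp: \<gamma>_def intro!: derivative_eq_intros)
  qed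
qed

lemma trajectory_stays_in_cell:
  assumes n: "n \<ge> 1" and inj: "inj_on x {1..n}" and \<gamma>: "gfa_trajectory n x T \<gamma>"
  obtains i where "i \<in> {1..n}" "\<And>t. t \<in> {0..T} \<Longrightarrow> \<gamma> t \<in> cell n x i"
proof -
  have T: "0 \<le> T" using \<gamma> by (simp add: gfa_trajectory_def)
  have ex: "\<exists>i\<in>{1..n}. \<gamma> t \<in> cell n x i" if "t \<in> {0..T}" for t
    using GDERIV_energy_imp_cell[OF n inj] \<gamma> that unfolding gfa_trajectory_def by blast
  have "continuous_on {0..T} \<gamma>"
    unfolding continuous_on_eq_continuous_within
    using \<gamma> has_vector_derivative_continuous unfolding gfa_trajectory_def by blast
  then have conn: "connected (\<gamma> ` {0..T})" by (simp add: connected_continuous_image)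
  obtain i where i: "i \<in> {1..n}" "\<gamma> 0 \<in> cell n x i" using ex[of 0] T by auto
  \<comment> \<open>The other cells are merged into one open set, so that connectedness of the path
    is applied to just two disjoint open sets.\<close>
  let ?V = "\<Union>j\<in>{1..n}-{i}. cell n x j"
  have "open ?V" by (auto intro: open_cell)
  moreover have "cell n x i \<inter> ?V \<inter> \<gamma> ` {0..T} = {}"
    using cell_disjoint[OF i(1), of _ _ x] by blast
  moreover have "\<gamma> ` {0..T} \<subseteq> cell n x i \<union> ?V" using ex by blast
  ultimately have "cell n x i \<inter> \<gamma> ` {0..T} = {} \<or> ?V \<inter> \<gamma> ` {0..T} = {}"
    by (intro connectedD[OF conn open_cell])
  moreover have "\<gamma> 0 \<in> \<gamma> ` {0..T}" using T by auto
  ultimately have "?V \<inter> \<gamma> ` {0..T} = {}" using i by blast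
  then have "\<gamma> t \<in> cell n x i" if "t \<in> {0..T}" for t
    using ex[OF that] that by blast
  then show ?thesis using that i by blast
qed

text \<open>The first disjunct is the case of a trajectory of length \<open>T = 0\<close>: then \<open>x k\<close> touches \<open>p\<close> but need
  not be its nearest particle.\<close>
lemma attaches_iff:
  assumes n: "n \<ge> 1" and inj: "inj_on x {1..n}" and k: "k \<in> {1..n}"
  shows "attaches n x p k \<longleftrightarrow>
    (p \<in> (\<Union>i\<in>{1..n}. cell n x i) \<and> dist p (x k) = 1) \<or> (p \<in> cell n x k \<and> dist p (x k) > 1)"
    (is "_ \<longleftrightarrow> ?A \<or> ?B")
proof
  assume "attaches n x p k"
  then obtain q T \<gamma> where q: "dist q (x k) = 1" and \<gamma>: "gfa_trajectory n x T \<gamma>" "\<gamma> 0 = p" "\<gamma> T = q"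
    and out: "\<And>t i. t \<in> {0..<T} \<Longrightarrow> i \<in> {1..n} \<Longrightarrow> dist (\<gamma> t) (x i) > 1"
    unfolding attaches_def new_particle_def by auto
  have T: "0 \<le> T" using \<gamma> by (simp add: gfa_trajectory_def)
  obtain i where i: "i \<in> {1..n}" "\<And>t. t \<in> {0..T} \<Longrightarrow> \<gamma> t \<in> cell n x i"
    using trajectory_stays_in_cell[OF n inj \<gamma>(1)] by blast
  have p: "p \<in> cell n x i" using i(2)[of 0] \<gamma> T by simp
  show "?A \<or> ?B"
  proof (cases "T = 0")
    case True
    then show ?thesis using p q \<gamma> i by auto
  next
    case False
    then have T: "T > 0" using T by simp
    have "continuous_on {0..T} \<gamma>"
      unfolding continuous_on_eq_continuous_within
      using \<gamma> has_vector_derivative_continuous unfolding gfa_trajectory_def by blast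
    \<comment> \<open>The distances are known to exceed 1 only before time \<open>T\<close>.
      Continuity gives the weak inequality at \<open>T\<close>, and if \<open>i\<close> differed
      from \<open>k\<close>, then \<open>x k\<close> would be strictly farther than 1.\<close>
    then have "continuous_on (closure {0..<T}) (\<lambda>t. dist (\<gamma> t) (x i))"
      using T by (auto intro: continuous_intros)
    then have "1 \<le> dist (\<gamma> T) (x i)"
      by (rule continuous_ge_on_closure) (use T out[OF _ i(1)] in \<open>auto intro: less_imp_le\<close>)
    moreover have "\<gamma> T \<in> cell n x i" using i T by auto
    moreover have "dist (\<gamma> T) (x i) < dist (\<gamma> T) (x k)" if "i \<noteq> k"
      using calculation(2) that k by (auto simp: cell_def)
    ultimately have "i = k" using q \<gamma>(3) by force
    then show ?thesis using p out[of 0 k] T \<gamma> k by simp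
  qed
next
  assume "?A \<or> ?B"
  then show "attaches n x p k"
  proof
    assume A: ?A
    then obtain i where i: "i \<in> {1..n}" "p \<in> cell n x i" by blast
    \<comment> \<open>On the one-point interval every vector is a derivative, so resting at
      \<open>p\<close> for time 0 is a trajectory as soon as the gradient exists at
      \<open>p\<close>.\<close>
    have "gfa_trajectory n x 0 (\<lambda>_. p)"
      using GDERIV_energy_cell[OF i]
      by (auto simp: gfa_trajectory_def has_vector_derivative_def has_derivative_within_singleton_iff
          bounded_linear_scaleR_left)
    then have "new_particle n x p p"
      unfolding new_particle_def using A k by (intro exI[of _ 0] exI[of _ "\<lambda>_. p"]) auto
    then show ?thesis using A k by (auto simp: attaches_def)
  next
    assume B: ?B
    let ?\<gamma> = "\<lambda>t. p - t *\<^sub>R sgn (p - x k)" and ?T = "dist p (x k) - 1"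
    note st = straight_trajectory[of k n p x]
    have "dist (?\<gamma> t) (x i) > 1" if t: "t \<in> {0..<?T}" and i: "i \<in> {1..n}" for t i
    proof -
      have "dist (?\<gamma> t) (x k) > 1" using st(3)[of t] B k t by auto
      moreover have "?\<gamma> t \<in> cell n x k" using st(4)[of t] B k t by auto
      moreover have "dist (?\<gamma> t) (x k) < dist (?\<gamma> t) (x i)" if "i \<noteq> k"
        using calculation(2) that i by (auto simp: cell_def)
      ultimately show ?thesis by fastforce
    qed
    then have "new_particle n x p (?\<gamma> ?T)"
      unfolding new_particle_def using st(1,2) B k
      by (intro exI[of _ ?T] exI[of _ ?\<gamma>] conjI ballI bexI[of _ k]) simp_all
    then show ?thesis using st(2) B k by (auto simp: attaches_def)
  qed
qed

section \<open>Directions and arcs\<close>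

definition dir :: "real \<Rightarrow> real^2" where
  "dir \<phi> = vector [cos \<phi>, sin \<phi>]"

lemma inner_dir: "dir \<phi> \<bullet> d = cos \<phi> * d $ 1 + sin \<phi> * d $ 2"
  by (simp add: dir_def inner_vec_def sum_2)

lemma inner_dir_dir: "dir \<phi> \<bullet> dir \<alpha> = cos (\<phi> - \<alpha>)"
  by (simp add: inner_dir) (simp add: dir_def cos_diff)

lemma norm_dir [simp]: "norm (dir \<phi>) = 1"
  by (simp add: norm_eq_sqrt_inner inner_dir_dir)

lemma polar_form:
  fixes d :: "real^2"
  obtains \<alpha> where "0 \<le> \<alpha>" "\<alpha> < 2 * pi" "d = norm d *\<^sub>R dir \<alpha>"
proof (cases "d = 0")
  case True
  then show ?thesis using that[of 0] by simp
next
  case False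
  have "(norm d)\<^sup>2 = (d $ 1)\<^sup>2 + (d $ 2)\<^sup>2"
    unfolding power2_norm_eq_inner by (simp add: inner_vec_def sum_2 power2_eq_square)
  then have "(d $ 1 / norm d)\<^sup>2 + (d $ 2 / norm d)\<^sup>2 = (norm d)\<^sup>2 / (norm d)\<^sup>2"
    by (simp only: power_divide add_divide_distrib)
  then have "(d $ 1 / norm d)\<^sup>2 + (d $ 2 / norm d)\<^sup>2 = 1" using False by simp
  then obtain \<alpha> where \<alpha>: "0 \<le> \<alpha>" "\<alpha> < 2 * pi" "d $ 1 / norm d = cos \<alpha>" "d $ 2 / norm d = sin \<alpha>"
    using sincos_total_2pi by metis
  have "d $ 1 = norm d * cos \<alpha>" "d $ 2 = norm d * sin \<alpha>"
    unfolding \<alpha>(3,4)[symmetric] using False by simp_all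
  then have "d = norm d *\<^sub>R dir \<alpha>"
    unfolding vec_eq_iff forall_2 by (simp only: dir_def vector_scaleR_component vector_2 real_scaleR_def)
  with \<alpha>(1,2) show ?thesis by (rule that)
qed

lemma continuous_on_dir: "continuous_on A dir"
proof -
  have "dir = (\<lambda>\<phi>. \<chi> i. if i = 1 then cos \<phi> else sin \<phi>)"
    by (simp add: fun_eq_iff vec_eq_iff forall_2 dir_def)
  moreover have "continuous_on A (\<lambda>\<phi>::real. \<chi> i. if i = (1::2) then cos \<phi> else sin \<phi>)"
  proof (rule continuous_on_vec_lambda)
    show "continuous_on A (\<lambda>\<phi>::real. if i = (1::2) then cos \<phi> else sin \<phi>)" for i
      by (cases "i = 1") (auto intro: continuous_intros)
  qed
  ultimately show ?thesis by (simp only:)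
qed

lemma borel_measurable_dir [measurable]: "dir \<in> borel_measurable borel"
  by (intro borel_measurable_continuous_onI continuous_on_dir)

lemma AE_inner_dir_nonzero:
  assumes "d \<noteq> 0"
  shows "AE \<phi> in lborel. dir \<phi> \<bullet> d \<noteq> 0"
proof -
  obtain \<alpha> where \<alpha>: "d = norm d *\<^sub>R dir \<alpha>" by (rule polar_form)
  \<comment> \<open>Only the odd multiples of \<open>pi / 2\<close> occur; the larger set of all
    multiples is still countable, hence null.\<close>
  have "{\<phi>. dir \<phi> \<bullet> d = 0} \<subseteq> range (\<lambda>i::int. \<alpha> + of_int i * (pi / 2))"
  proof
    fix \<phi> assume "\<phi> \<in> {\<phi>. dir \<phi> \<bullet> d = 0}"
    then have "dir \<phi> \<bullet> (norm d *\<^sub>R dir \<alpha>) = 0" by (simp only: \<alpha>[symmetric] mem_Collect_eq)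
    then have "norm d * cos (\<phi> - \<alpha>) = 0" by (simp only: inner_scaleR_right inner_dir_dir)
    then have "cos (\<phi> - \<alpha>) = 0" using assms by simp
    then obtain i :: int where "\<phi> - \<alpha> = of_int i * (pi / 2)"
      unfolding cos_zero_iff_int by blast
    then show "\<phi> \<in> range (\<lambda>i::int. \<alpha> + of_int i * (pi / 2))"
      by (intro image_eqI[of _ _ i]) (auto simp: algebra_simps)
  qed
  then have "countable {\<phi>. dir \<phi> \<bullet> d = 0}"
    by (rule countable_subset) auto
  then have "{\<phi>. dir \<phi> \<bullet> d = 0} \<in> null_sets lborel"
    by (rule countable_imp_null_set_lborel)
  then show ?thesis by (rule AE_I') auto
qed

section \<open>Lengths of intersections of half circles\<close>

lemma measure_period_shift:
  fixes S :: "real set"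
  assumes S[measurable]: "S \<in> sets borel" and per: "\<And>t. t + c \<in> S \<longleftrightarrow> t \<in> S" and a: "0 \<le> a" "a \<le> c"
  shows "measure lborel (S \<inter> {a..<a + c}) = measure lborel (S \<inter> {0..<c})"
proof -
  have fin: "S \<inter> {u..<v} \<in> fmeasurable lborel" for u v
    by (rule fmeasurableI2[of "cbox u v"]) (auto simp: fmeasurable_def emeasure_lborel_Icc_eq)
  have "S \<inter> {c..<a + c} = (+) c ` (S \<inter> {0..<a})"
  proof (intro set_eqI iffI)
    fix t assume "t \<in> S \<inter> {c..<a + c}"
    then show "t \<in> (+) c ` (S \<inter> {0..<a})"
      using per[of "t - c"] by (intro image_eqI[of _ _ "t - c"]) auto
  qed (use per in \<open>auto simp: add.commute\<close>)
  then have "measure lebesgue (S \<inter> {c..<a + c}) = measure lebesgue (S \<inter> {0..<a})"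
    by (simp only: measure_translation)
  then have tr: "measure lborel (S \<inter> {c..<a + c}) = measure lborel (S \<inter> {0..<a})"
    by (simp add: measure_completion)
  \<comment> \<open>The part of the window beyond \<open>c\<close> is moved back by one period and
    fills the missing initial part.\<close>
  have "S \<inter> {a..<a + c} = (S \<inter> {a..<c}) \<union> (S \<inter> {c..<a + c})" using a by auto
  then have "measure lborel (S \<inter> {a..<a + c}) = measure lborel (S \<inter> {a..<c}) + measure lborel (S \<inter> {c..<a + c})"
    by (simp only:) (rule measure_Un_AE, use fin in auto)
  also have "\<dots> = measure lborel (S \<inter> {0..<a}) + measure lborel (S \<inter> {a..<c})"
    using tr by simp
  also have "\<dots> = measure lborel ((S \<inter> {0..<a}) \<union> (S \<inter> {a..<c}))"
    by (rule measure_Un_AE[symmetric]) (use fin in auto)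
  also have "(S \<inter> {0..<a}) \<union> (S \<inter> {a..<c}) = S \<inter> {0..<c}" using a by auto
  finally show ?thesis .
qed

lemma cos_neg_iff:
  assumes "- (pi / 2) \<le> t" "t \<le> 5 * pi / 2"
  shows "cos t < 0 \<longleftrightarrow> pi / 2 < t \<and> t < 3 * pi / 2"
proof -
  consider "t \<le> pi / 2" | "pi / 2 < t" "t < 3 * pi / 2" | "3 * pi / 2 \<le> t" by linarith
  then show ?thesis
  proof cases
    case 1
    then show ?thesis using cos_ge_zero[of t] assms by simp
  next
    case 2
    then show ?thesis using cos_gt_zero_pi[of "t - pi"] by simp
  next
    case 3
    then have "0 \<le> cos (t - 2 * pi)" using assms by (intro cos_ge_zero) auto
    then show ?thesis using 3 cos_periodic[of "t - 2 * pi"] by simp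
  qed
qed

text \<open>Starting the period at \<open>\<alpha>\<close> avoids wrap-around: relative to
  \<open>\<alpha>\<close> the half circles are the intervals from \<open>pi / 2\<close> to
  \<open>3 * pi / 2\<close> and from \<open>pi / 2 + \<delta>\<close> to
  \<open>3 * pi / 2 + \<delta>\<close>, which overlap in a single interval.\<close>

lemma measure_two_half_circles_angle:
  assumes "0 \<le> \<alpha>" "\<alpha> < 2 * pi" "0 \<le> \<delta>" "\<delta> \<le> pi"
  shows "measure lborel {\<phi>\<in>{0..<2 * pi}. cos (\<phi> - \<alpha>) < 0 \<and> cos (\<phi> - \<alpha> - \<delta>) < 0} = pi - \<delta>"
proof -
  let ?S = "{\<phi>. cos (\<phi> - \<alpha>) < 0 \<and> cos (\<phi> - \<alpha> - \<delta>) < 0}"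
  have "measure lborel (?S \<inter> {\<alpha>..<\<alpha> + 2 * pi}) = measure lborel (?S \<inter> {0..<2 * pi})"
  proof (rule measure_period_shift)
    have "t + 2 * pi - \<alpha> = (t - \<alpha>) + 2 * pi" "t + 2 * pi - \<alpha> - \<delta> = (t - \<alpha> - \<delta>) + 2 * pi" for t
      by auto
    then show "t + 2 * pi \<in> ?S \<longleftrightarrow> t \<in> ?S" for t
      by (simp only: mem_Collect_eq cos_periodic)
  qed (use assms in auto)
  moreover have "?S \<inter> {\<alpha>..<\<alpha> + 2 * pi} = {\<alpha> + \<delta> + pi / 2<..<\<alpha> + 3 * pi / 2}"
  proof (intro set_eqI)
    fix \<phi>
    show "\<phi> \<in> ?S \<inter> {\<alpha>..<\<alpha> + 2 * pi} \<longleftrightarrow> \<phi> \<in> {\<alpha> + \<delta> + pi / 2<..<\<alpha> + 3 * pi / 2}"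
    proof (cases "\<alpha> \<le> \<phi> \<and> \<phi> < \<alpha> + 2 * pi")
      case True
      show ?thesis
      \<comment> \<open>Up to \<open>pi / 2\<close> the first condition already fails. Beyond it,
        \<open>\<phi> - \<alpha> - \<delta>\<close> is at least \<open>- (pi / 2)\<close>, which is
        the range where \<open>cos_neg_iff\<close> applies.\<close>
      proof (cases "\<phi> - \<alpha> > pi / 2")
        case t: True
        then show ?thesis
          using True assms cos_neg_iff[of "\<phi> - \<alpha>"] cos_neg_iff[of "\<phi> - \<alpha> - \<delta>"] by auto
      next
        case False
        then show ?thesis using True assms cos_neg_iff[of "\<phi> - \<alpha>"] by auto
      qed
    qed (use assms in auto)
  qed
  moreover have "?S \<inter> {0..<2 * pi} = {\<phi>\<in>{0..<2 * pi}. cos (\<phi> - \<alpha>) < 0 \<and> cos (\<phi> - \<alpha> - \<delta>) < 0}"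
    by auto
  ultimately show ?thesis using assms by simp
qed

lemma measure_two_half_circles:
  fixes a b :: "real^2"
  assumes "a \<noteq> 0" "b \<noteq> 0"
  shows "measure lborel {\<phi>\<in>{0..<2 * pi}. dir \<phi> \<bullet> a < 0 \<and> dir \<phi> \<bullet> b < 0}
    = pi - arccos (a \<bullet> b / (norm a * norm b))"
proof -
  have cos_case: "measure lborel {\<phi>\<in>{0..<2 * pi}. cos (\<phi> - \<alpha>) < 0 \<and> cos (\<phi> - \<beta>) < 0}
      = pi - arccos (cos (\<beta> - \<alpha>))" if "0 \<le> \<alpha>" "\<alpha> \<le> \<beta>" "\<beta> < 2 * pi" for \<alpha> \<beta>
  proof (cases "\<beta> - \<alpha> \<le> pi")
    case True
    then show ?thesis
      using measure_two_half_circles_angle[of \<alpha> "\<beta> - \<alpha>"] that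
      by (simp add: arccos_cos)
  next
    case False
    \<comment> \<open>For a difference above \<open>pi\<close> the unsigned angle is measured the
      other way round, from \<open>\<beta>\<close> forward to \<open>\<alpha>\<close>.\<close>
    let ?\<delta> = "2 * pi - (\<beta> - \<alpha>)"
    have "cos (\<phi> - \<beta> - ?\<delta>) = cos (\<phi> - \<alpha>)" for \<phi>
      using cos_periodic[of "\<phi> - \<beta> - ?\<delta>"] by simp
    moreover have "cos (\<beta> - \<alpha>) = cos ?\<delta>"
      by (metis cos_2pi_minus)
    moreover have "arccos (cos ?\<delta>) = ?\<delta>" using that False by (intro arccos_cos) auto
    ultimately show ?thesis
      using measure_two_half_circles_angle[of \<beta> ?\<delta>] that False
      by (simp add: conj_commute)
  qed
  obtain \<alpha> where \<alpha>: "0 \<le> \<alpha>" "\<alpha> < 2 * pi" "a = norm a *\<^sub>R dir \<alpha>" by (rule polar_form)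
  obtain \<beta> where \<beta>: "0 \<le> \<beta>" "\<beta> < 2 * pi" "b = norm b *\<^sub>R dir \<beta>" by (rule polar_form)
  have "dir \<phi> \<bullet> a = norm a * cos (\<phi> - \<alpha>)" for \<phi>
    by (subst \<alpha>(3)) (simp add: inner_dir_dir)
  then have da: "dir \<phi> \<bullet> a < 0 \<longleftrightarrow> cos (\<phi> - \<alpha>) < 0" for \<phi>
    using assms by (simp add: mult_less_0_iff)
  have "dir \<phi> \<bullet> b = norm b * cos (\<phi> - \<beta>)" for \<phi>
    by (subst \<beta>(3)) (simp add: inner_dir_dir)
  then have db: "dir \<phi> \<bullet> b < 0 \<longleftrightarrow> cos (\<phi> - \<beta>) < 0" for \<phi>
    using assms by (simp add: mult_less_0_iff)
  have "a \<bullet> b = norm a * norm b * cos (\<alpha> - \<beta>)"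
    by (subst \<alpha>(3), subst \<beta>(3)) (simp add: inner_dir_dir)
  then have ab: "a \<bullet> b / (norm a * norm b) = cos (\<alpha> - \<beta>)"
    using assms by simp
  show ?thesis
  proof (cases "\<alpha> \<le> \<beta>")
    case True
    have "cos (\<alpha> - \<beta>) = cos (\<beta> - \<alpha>)" by (metis cos_minus minus_diff_eq)
    then show ?thesis using cos_case[of \<alpha> \<beta>] True \<alpha>(1) \<beta>(2) by (simp add: da db ab)
  next
    case False
    then show ?thesis using cos_case[of \<beta> \<alpha>] \<alpha>(2) \<beta>(1) by (simp add: da db ab conj_commute)
  qed
qed

section \<open>Normal cones of planar polygons\<close>

text \<open>For finite \<open>X\<close> and \<open>v\<close> in \<open>X\<close> this is the
  interior of the normal cone of the hull at \<open>v\<close>: the directions whose linear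
  functional has \<open>v\<close> as its only maximiser on \<open>X\<close>.\<close>

definition normal_dirs :: "'a::real_inner set \<Rightarrow> 'a \<Rightarrow> 'a set" where
  "normal_dirs X v = {u. \<forall>y\<in>X - {v}. u \<bullet> (y - v) < 0}"

lemma normal_dirs_hull:
  assumes "u \<in> normal_dirs X v" "v \<in> X" "y \<in> convex hull X" "y \<noteq> v"
  shows "u \<bullet> (y - v) < 0"
proof -
  \<comment> \<open>An open half-space with one point of its bounding hyperplane added is still
    convex, so the strict inequality passes from \<open>X\<close> to its hull.\<close>
  let ?C = "insert v {z. u \<bullet> z < u \<bullet> v}"
  have "convex ?C"
  proof (rule convexI)
    fix p q :: 'a and s t :: real
    assume pq: "p \<in> ?C" "q \<in> ?C" and st: "0 \<le> s" "0 \<le> t" "s + t = 1"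
    show "s *\<^sub>R p + t *\<^sub>R q \<in> ?C"
    proof (cases "s = 0 \<or> t = 0 \<or> (p = v \<and> q = v)")
      case True
      then show ?thesis using pq st by (auto simp flip: scaleR_add_left)
    next
      case False
      then have "s > 0" "t > 0" using st by auto
      have "s * (u \<bullet> p) + t * (u \<bullet> q) < s * (u \<bullet> v) + t * (u \<bullet> v)"
      proof (cases "p = v")
        case True
        then show ?thesis using False pq \<open>t > 0\<close> by simp
      next
        case p: False
        have "u \<bullet> q \<le> u \<bullet> v" using pq by auto
        then show ?thesis using p pq \<open>s > 0\<close> \<open>t > 0\<close>
          by (intro add_less_le_mono) auto
      qed
      also have "\<dots> = u \<bullet> v" using st by (simp flip: distrib_right)
      finally show ?thesis by (simp add: inner_add_right)
    qed
  qed
  moreover have "X \<subseteq> ?C"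
    using assms(1) by (auto simp: normal_dirs_def inner_diff_right)
  ultimately have "convex hull X \<subseteq> ?C" by (rule hull_minimal[rotated])
  then show ?thesis using assms by (auto simp: inner_diff_right)
qed

lemma normal_dirs_rel_interior_edge:
  assumes "v \<in> X" and e: "e edge_of (convex hull X)" and v: "v \<in> rel_interior e"
  shows "normal_dirs X v = {}"
proof -
  have "e \<noteq> {v}" using e by (auto simp: edge_of_def)
  have "e \<subseteq> convex hull X" using e by (rule edge_of_imp_subset)
  have "v \<in> e" using v rel_interior_subset by blast
  then obtain w where w: "w \<in> e" "w \<noteq> v" using \<open>e \<noteq> {v}\<close> by blast
  have "convex e" using e face_of_imp_convex unfolding edge_of_def by blast
  have "w \<in> affine hull e" using w by (simp add: hull_inc)
  \<comment> \<open>As \<open>v\<close> is relatively interior, the segment from \<open>w\<close>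
    extends beyond \<open>v\<close> within \<open>e\<close>. The new point lies opposite
    \<open>w\<close>, so no functional can be negative on both differences from
    \<open>v\<close>.\<close>
  then obtain m where m: "m > 1" "(1 - m) *\<^sub>R w + m *\<^sub>R v \<in> e"
    using convex_rel_interior_if[OF \<open>convex e\<close> v] by auto
  let ?z = "(1 - m) *\<^sub>R w + m *\<^sub>R v"
  have zv: "?z - v = (1 - m) *\<^sub>R (w - v)" by (simp add: algebra_simps)
  have False if u: "u \<in> normal_dirs X v" for u
  proof -
    have "u \<bullet> (w - v) < 0" using normal_dirs_hull[OF u] assms w \<open>e \<subseteq> _\<close> by blast
    moreover have "?z \<noteq> v" using zv w m by auto
    then have "u \<bullet> (?z - v) < 0" using normal_dirs_hull[OF u] assms m \<open>e \<subseteq> _\<close> by blast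
    then have "(1 - m) * (u \<bullet> (w - v)) < 0" by (simp only: zv inner_scaleR_right)
    ultimately show False using m by (simp add: mult_less_0_iff)
  qed
  then show ?thesis by blast
qed

text \<open>The hull is a segment and hence an edge of itself, so \<open>v\<close> must be one of
  its ends. All other points are positive multiples away from \<open>v\<close> in the direction of
  the far end \<open>c\<close>, which leaves a single half-plane condition.\<close>

lemma normal_dirs_segment_end:
  fixes X :: "(real^2) set"
  assumes fin: "finite X" and v: "v \<in> X" and X: "X \<noteq> {v}" and col: "collinear X"
    and ne: "\<not> (\<exists>e. e edge_of (convex hull X) \<and> v \<in> rel_interior e)"
  obtains d where "d \<noteq> 0" "normal_dirs X v = {u. u \<bullet> d < 0}"
proof -
  have col_hull: "collinear (convex hull X)"
    using col by (simp add: collinear_aff_dim aff_dim_convex_hull)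
  have comp: "compact (convex hull X)"
    using fin by (simp add: finite_imp_compact compact_convex_hull)
  have "convex hull X \<noteq> {}" using v by auto
  then obtain a b where ab: "convex hull X = closed_segment a b"
    using compact_convex_collinear_segment[OF _ comp convex_convex_hull col_hull] by metis
  obtain w where w: "w \<in> X" "w \<noteq> v" using X v by blast
  have "v \<in> closed_segment a b" "w \<in> closed_segment a b"
    using hull_inc[of _ X convex] v w by (auto simp flip: ab)
  then have "a \<noteq> b" using w by auto
  have "convex hull X edge_of convex hull X"
    unfolding edge_of_def by (simp add: face_of_refl ab \<open>a \<noteq> b\<close> aff_dim_2 segment_convex_hull aff_dim_convex_hull)
  then have "v \<notin> open_segment a b"
    using ne ab \<open>a \<noteq> b\<close> by (metis rel_interior_closed_segment)
  then have "v = a \<or> v = b"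
    using \<open>v \<in> closed_segment a b\<close> by (auto simp: open_segment_def)
  then obtain c where c: "convex hull X = closed_segment v c" "c \<noteq> v"
    using ab \<open>a \<noteq> b\<close> closed_segment_commute by metis
  have "c extreme_point_of (convex hull X)"
    unfolding c by (simp add: extreme_point_of_segment)
  then have cX: "c \<in> X" by (rule extreme_point_of_convex_hull)
  have "normal_dirs X v = {u. u \<bullet> (c - v) < 0}"
  proof (intro set_eqI iffI)
    fix u assume "u \<in> normal_dirs X v"
    then show "u \<in> {u. u \<bullet> (c - v) < 0}" using cX c by (auto simp: normal_dirs_def)
  next
    fix u assume u: "u \<in> {u. u \<bullet> (c - v) < 0}"
    have "u \<bullet> (y - v) < 0" if "y \<in> X - {v}" for y
    proof -
      have "y \<in> closed_segment v c" using that hull_inc[of y X convex] by (simp flip: c)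
      then obtain t where t: "0 \<le> t" "y = (1 - t) *\<^sub>R v + t *\<^sub>R c"
        by (auto simp: closed_segment_def)
      then have y: "y - v = t *\<^sub>R (c - v)" by (simp add: algebra_simps)
      then have "t \<noteq> 0" using that by auto
      then show ?thesis using y t u by (simp add: mult_less_0_iff mult_pos_neg)
    qed
    then show "u \<in> normal_dirs X v" by (simp add: normal_dirs_def)
  qed
  then show ?thesis using that[of "c - v"] c by simp
qed

section \<open>Vertices and their two edges\<close>

lemma dual_basis_expansion:
  fixes d1 d2 y n1 n2 :: "real^2"
  assumes "n1 \<bullet> d1 = 0" "n1 \<bullet> d2 < 0" "n2 \<bullet> d2 = 0" "n2 \<bullet> d1 < 0"
  shows "y = ((n2 \<bullet> y) / (n2 \<bullet> d1)) *\<^sub>R d1 + ((n1 \<bullet> y) / (n1 \<bullet> d2)) *\<^sub>R d2" (is "y = ?z")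
proof -
  \<comment> \<open>Up to scaling, \<open>n1\<close> and \<open>n2\<close> form the dual basis of
    \<open>d2\<close> and \<open>d1\<close>. Their determinant is nonzero, so a vector orthogonal to
    both, such as the error of the expansion, is zero.\<close>
  let ?D = "n1 $ 1 * n2 $ 2 - n1 $ 2 * n2 $ 1"
  have D: "?D \<noteq> 0"
  proof
    assume D0: "?D = 0"
    have e1: "n1 $ 1 * d1 $ 1 + n1 $ 2 * d1 $ 2 = 0" using assms by (simp add: inner_vec_def sum_2)
    have e2: "n2 $ 1 * d1 $ 1 + n2 $ 2 * d1 $ 2 \<noteq> 0" using assms by (simp add: inner_vec_def sum_2)
    have "n1 $ 1 * (n2 $ 1 * d1 $ 1 + n2 $ 2 * d1 $ 2) =
        n2 $ 1 * (n1 $ 1 * d1 $ 1 + n1 $ 2 * d1 $ 2) + ?D * d1 $ 2" by algebra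
    then have "n1 $ 1 = 0" using D0 e1 e2 by simp
    have "n1 $ 2 * (n2 $ 1 * d1 $ 1 + n2 $ 2 * d1 $ 2) =
        n2 $ 2 * (n1 $ 1 * d1 $ 1 + n1 $ 2 * d1 $ 2) - ?D * d1 $ 1" by algebra
    then have "n1 $ 2 = 0" using D0 e1 e2 by simp
    then show False using assms \<open>n1 $ 1 = 0\<close> by (simp add: inner_vec_def sum_2)
  qed
  define z where "z = y - ?z"
  have "n1 \<bullet> z = 0" "n2 \<bullet> z = 0"
    using assms by (simp_all add: z_def inner_diff_right inner_add_right)
  then have e: "n1 $ 1 * z $ 1 + n1 $ 2 * z $ 2 = 0" "n2 $ 1 * z $ 1 + n2 $ 2 * z $ 2 = 0"
    by (simp_all add: inner_vec_def sum_2)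
  have "?D * z $ 1 = 0" "?D * z $ 2 = 0" using e by algebra+
  then have "z = 0" using D by (simp add: vec_eq_iff forall_2)
  then show ?thesis by (simp add: z_def)
qed

lemma edge_supporting_line:
  fixes X :: "'a::euclidean_space set"
  assumes fin: "finite X" and e: "e edge_of (convex hull X)" and v: "v \<in> e"
  obtains c where "\<And>y. y \<in> convex hull X \<Longrightarrow> c \<bullet> (y - v) \<le> 0"
    "\<And>y. y \<in> convex hull X \<Longrightarrow> c \<bullet> (y - v) = 0 \<longleftrightarrow> y \<in> e"
proof -
  have "polyhedron (convex hull X)" using fin by (rule polyhedron_convex_hull)
  then have "e exposed_face_of (convex hull X)"
    using e by (simp add: exposed_face_of_polyhedron edge_of_def)
  then obtain c b where c: "convex hull X \<subseteq> {x. c \<bullet> x \<le> b}" "e = convex hull X \<inter> {x. c \<bullet> x = b}"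
    unfolding exposed_face_of_def by blast
  then have "c \<bullet> v = b" using v by auto
  then show ?thesis using that[of c] c by (auto simp: inner_diff_right)
qed

text \<open>The hull lies in the cone at \<open>v\<close> spanned by the two edge directions: the
  outer normals of the edges act as a dual basis and make both coordinates nonnegative. Negativity
  on the two edge directions therefore implies it on all of \<open>X - {v}\<close>.\<close>

lemma normal_dirs_vertex:
  fixes X :: "(real^2) set"
  assumes fin: "finite X" and v: "v \<in> X" and ab: "a \<noteq> b"
    and a: "closed_segment v a edge_of (convex hull X)"
    and b: "closed_segment v b edge_of (convex hull X)"
  shows "normal_dirs X v = {u. u \<bullet> (a - v) < 0 \<and> u \<bullet> (b - v) < 0}" "a \<noteq> v" "b \<noteq> v"
proof -
  show av: "a \<noteq> v" using a by (auto simp: edge_of_def)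
  show bv: "b \<noteq> v" using b by (auto simp: edge_of_def)
  have aH: "a \<in> convex hull X" and bH: "b \<in> convex hull X"
    using edge_of_imp_subset[OF a] edge_of_imp_subset[OF b] by auto
  have aX: "a \<in> X" and bX: "b \<in> X"
    using a b by (auto simp: edge_of_def dest!: segment_face_of(2) intro: extreme_point_of_convex_hull)
  obtain n1 where n1: "\<And>y. y \<in> convex hull X \<Longrightarrow> n1 \<bullet> (y - v) \<le> 0"
      "\<And>y. y \<in> convex hull X \<Longrightarrow> n1 \<bullet> (y - v) = 0 \<longleftrightarrow> y \<in> closed_segment v a"
    using edge_supporting_line[OF fin a, of v] by auto
  obtain n2 where n2: "\<And>y. y \<in> convex hull X \<Longrightarrow> n2 \<bullet> (y - v) \<le> 0"
      "\<And>y. y \<in> convex hull X \<Longrightarrow> n2 \<bullet> (y - v) = 0 \<longleftrightarrow> y \<in> closed_segment v b"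
    using edge_supporting_line[OF fin b, of v] by auto
  have ext: "a extreme_point_of (convex hull X)" "b extreme_point_of (convex hull X)"
    using a b by (auto simp: edge_of_def dest: segment_face_of(2))
  have vH: "v \<in> convex hull X" using v by (simp add: hull_inc)
  \<comment> \<open>An extreme point cannot lie inside a segment of the hull. This makes the mixed
    inner products strictly negative.\<close>
  have b1: "b \<notin> closed_segment v a"
    using ext(2) vH aH ab bv unfolding extreme_point_of_def open_segment_def by blast
  have a2: "a \<notin> closed_segment v b"
    using ext(1) vH bH ab av unfolding extreme_point_of_def open_segment_def by blast
  have s: "n1 \<bullet> (a - v) = 0" "n2 \<bullet> (b - v) = 0" "n1 \<bullet> (b - v) < 0" "n2 \<bullet> (a - v) < 0"
    using n1 n2 aH bH b1 a2 by (force simp: less_le)+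
  show "normal_dirs X v = {u. u \<bullet> (a - v) < 0 \<and> u \<bullet> (b - v) < 0}"
  proof (intro set_eqI iffI)
    fix u assume "u \<in> normal_dirs X v"
    then show "u \<in> {u. u \<bullet> (a - v) < 0 \<and> u \<bullet> (b - v) < 0}"
      using aX bX av bv by (auto simp: normal_dirs_def)
  next
    fix u assume "u \<in> {u. u \<bullet> (a - v) < 0 \<and> u \<bullet> (b - v) < 0}"
    then have u: "u \<bullet> (a - v) < 0" "u \<bullet> (b - v) < 0" by auto
    have "u \<bullet> (y - v) < 0" if y: "y \<in> X - {v}" for y
    proof -
      have yH: "y \<in> convex hull X" using y by (simp add: hull_inc)
      define p where "p = (n2 \<bullet> (y - v)) / (n2 \<bullet> (a - v))"
      define q where "q = (n1 \<bullet> (y - v)) / (n1 \<bullet> (b - v))"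
      have pq: "p \<ge> 0" "q \<ge> 0"
        using n1(1)[OF yH] n2(1)[OF yH] s by (simp_all add: p_def q_def divide_nonpos_neg)
      have yv: "y - v = p *\<^sub>R (a - v) + q *\<^sub>R (b - v)"
        unfolding p_def q_def by (rule dual_basis_expansion) (use s in auto)
      then have "p > 0 \<or> q > 0" using pq y by (cases "p = 0"; cases "q = 0") auto
      then have "p * (u \<bullet> (a - v)) + q * (u \<bullet> (b - v)) < 0"
      proof
        assume "p > 0"
        then show ?thesis using u pq
          by (intro add_neg_nonpos) (auto simp: mult_pos_neg mult_nonneg_nonpos)
      next
        assume "q > 0"
        then show ?thesis using u pq
          by (intro add_nonpos_neg) (auto simp: mult_pos_neg mult_nonneg_nonpos)
      qed
      then show ?thesis by (simp add: yv inner_add_right)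
    qed
    then show "u \<in> normal_dirs X v" by (simp add: normal_dirs_def)
  qed
qed

text \<open>The supporting line cuts out a compact face inside a line, so a segment. It is
  non-degenerate because of \<open>z\<close>, and \<open>v\<close>, being extreme, is one of its
  ends.\<close>

lemma edge_on_supporting_line:
  fixes H :: "(real^2) set"
  assumes H: "convex H" "compact H" and v: "v extreme_point_of H" and n: "n \<noteq> 0"
    and supp: "\<And>y. y \<in> H \<Longrightarrow> n \<bullet> (y - v) \<le> 0"
    and z: "z \<in> H" "z \<noteq> v" "n \<bullet> (z - v) = 0"
  obtains a where "a \<noteq> v" "closed_segment v a edge_of H" "n \<bullet> (a - v) = 0"
proof -
  define F where "F = H \<inter> {y. n \<bullet> y = n \<bullet> v}"
  have F: "F face_of H"
    unfolding F_def by (rule face_of_Int_supporting_hyperplane_le) (use H supp in \<open>auto simp: inner_diff_right\<close>)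
  have zF: "z \<in> F" using z by (simp add: F_def inner_diff_right)
  have vF: "v \<in> F" using v by (simp add: F_def extreme_point_of_def)
  have "aff_dim F \<le> aff_dim {y. n \<bullet> y = n \<bullet> v}" by (rule aff_dim_subset) (auto simp: F_def)
  then have "collinear F" using n by (simp add: collinear_aff_dim)
  moreover have "compact F" "convex F"
    using F H by (auto intro: face_of_imp_compact face_of_imp_convex)
  ultimately obtain p q where pq: "F = closed_segment p q"
    using compact_convex_collinear_segment[of F] vF by auto
  have "v extreme_point_of F" using extreme_point_of_face[OF F] v vF by simp
  then have "v = p \<or> v = q" unfolding pq by (simp add: extreme_point_of_segment)
  then obtain a where a: "F = closed_segment v a"
    using pq closed_segment_commute by metis
  then have av: "a \<noteq> v" using zF z by auto
  have "aff_dim F = 1"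
    unfolding a segment_convex_hull aff_dim_convex_hull using av by (simp add: aff_dim_2)
  then have "closed_segment v a edge_of H" using F a by (simp add: edge_of_def)
  moreover have "n \<bullet> (a - v) = 0"
  proof -
    have "a \<in> F" by (simp add: a)
    then show ?thesis by (simp add: F_def inner_diff_right)
  qed
  ultimately show ?thesis using that av by blast
qed

text \<open>A line that touches the hull only at \<open>v\<close> is rotated about \<open>v\<close>
  in either sense until it meets another point of \<open>X\<close>. The two limiting lines carry the
  edges.\<close>

lemma two_edges_at_vertex:
  fixes X :: "(real^2) set"
  assumes fin: "finite X" and ncol: "\<not> collinear X" and v: "v extreme_point_of (convex hull X)"
  obtains a b where "a \<noteq> b" "closed_segment v a edge_of (convex hull X)"
    "closed_segment v b edge_of (convex hull X)"
proof -
  let ?H = "convex hull X"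
  have vX: "v \<in> X" using v by (rule extreme_point_of_convex_hull)
  have comp: "compact ?H" using fin by (simp add: finite_imp_compact compact_convex_hull)
  have "{v} exposed_face_of ?H"
    using v fin by (simp add: exposed_face_of_polyhedron polyhedron_convex_hull face_of_singleton)
  then obtain c \<beta> where c: "?H \<subseteq> {x. c \<bullet> x \<le> \<beta>}" "{v} = ?H \<inter> {x. c \<bullet> x = \<beta>}"
    unfolding exposed_face_of_def by blast
  have cneg: "c \<bullet> (y - v) < 0" if "y \<in> ?H" "y \<noteq> v" for y
  proof -
    have "c \<bullet> v = \<beta>" using c(2) by auto
    moreover have "c \<bullet> y \<le> \<beta>" "c \<bullet> y \<noteq> \<beta>" using c that by auto
    ultimately show ?thesis by (simp add: inner_diff_right)
  qed
  have "X \<noteq> {v}" using ncol by auto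
  then obtain y0 where "y0 \<in> X - {v}" using vX by blast
  \<comment> \<open>The normal \<open>c\<close> turned by a quarter; \<open>w\<close> and
    \<open>- w\<close> stand for the two senses of rotation.\<close>
  define w :: "real^2" where "w = vector [- (c $ 2), c $ 1]"
  have wc: "w \<bullet> c = 0" by (simp add: w_def inner_vec_def sum_2)
  have "c \<noteq> 0" using cneg[of y0] \<open>y0 \<in> X - {v}\<close> by (auto simp: hull_inc)
  then have w0: "w \<noteq> 0" by (auto simp: w_def vec_eq_iff forall_2)
  have step: "\<exists>a m. a \<noteq> v \<and> closed_segment v a edge_of ?H \<and> (w' + m *\<^sub>R c) \<bullet> (a - v) = 0 \<and>
      (\<forall>y\<in>?H. (w' + m *\<^sub>R c) \<bullet> (y - v) \<le> 0)" if w': "w' \<noteq> 0" "w' \<bullet> c = 0" for w'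
  proof -
    \<comment> \<open>The \<open>m\<close> for which \<open>w' + m *\<^sub>R c\<close> is orthogonal
      to \<open>y - v\<close>. Since \<open>c\<close> is negative on \<open>y - v\<close>, the
      inequality needed for support holds exactly for larger or equal \<open>m\<close>; the maximum
      over \<open>X - {v}\<close> is the first supporting position, with contact at the
      maximiser.\<close>
    define slope where "slope y = (w' \<bullet> (y - v)) / (- (c \<bullet> (y - v)))" for y
    define m where "m = Max (slope ` (X - {v}))"
    have "m \<in> slope ` (X - {v})"
      unfolding m_def using fin \<open>y0 \<in> X - {v}\<close> by (intro Max_in) auto
    then obtain z where z: "z \<in> X - {v}" "slope z = m" by blast
    have sl: "slope y \<le> m" if "y \<in> X - {v}" for y
      unfolding m_def using fin that by (intro Max_ge) auto
    let ?n = "w' + m *\<^sub>R c"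
    have eq: "?n \<bullet> (y - v) = (- (c \<bullet> (y - v))) * (slope y - m)" if "y \<in> X - {v}" for y
    proof -
      have "c \<bullet> (y - v) < 0" using cneg that by (simp add: hull_inc)
      then show ?thesis by (simp add: slope_def inner_add_left field_simps)
    qed
    have "X \<subseteq> {y. ?n \<bullet> y \<le> ?n \<bullet> v}"
    proof
      fix y assume "y \<in> X"
      have "?n \<bullet> (y - v) \<le> 0"
      proof (cases "y = v")
        case False
        then have y: "y \<in> X - {v}" using \<open>y \<in> X\<close> by simp
        have "c \<bullet> (y - v) < 0" using cneg y by (simp add: hull_inc)
        then show ?thesis using sl[OF y] unfolding eq[OF y] by (intro mult_nonneg_nonpos) auto
      qed simp
      then show "y \<in> {y. ?n \<bullet> y \<le> ?n \<bullet> v}" by (simp add: inner_diff_right)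
    qed
    then have "?H \<subseteq> {y. ?n \<bullet> y \<le> ?n \<bullet> v}" by (rule hull_minimal) (rule convex_halfspace_le)
    then have supp: "?n \<bullet> (y - v) \<le> 0" if "y \<in> ?H" for y
      using that by (auto simp: inner_diff_right)
    have "?n \<noteq> 0"
    proof
      assume "?n = 0"
      then have "w' \<bullet> ?n = 0" by simp
      then show False using w' by (simp add: inner_add_right)
    qed
    moreover have "?n \<bullet> (z - v) = 0" using eq[OF z(1)] z(2) by simp
    ultimately obtain a where "a \<noteq> v" "closed_segment v a edge_of ?H" "?n \<bullet> (a - v) = 0"
      using edge_on_supporting_line[OF convex_convex_hull comp v _ supp, of z] z by (auto simp: hull_inc)
    then show ?thesis using supp by blast
  qed
  obtain a m where a: "a \<noteq> v" "closed_segment v a edge_of ?H" "(w + m *\<^sub>R c) \<bullet> (a - v) = 0"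
    "\<And>y. y \<in> ?H \<Longrightarrow> (w + m *\<^sub>R c) \<bullet> (y - v) \<le> 0"
    using step[OF w0 wc] by blast
  obtain b k where b: "b \<noteq> v" "closed_segment v b edge_of ?H" "(- w + k *\<^sub>R c) \<bullet> (b - v) = 0"
    "\<And>y. y \<in> ?H \<Longrightarrow> (- w + k *\<^sub>R c) \<bullet> (y - v) \<le> 0"
    using step[of "- w"] w0 wc by auto
  have "a \<noteq> b"
  proof
    assume "a = b"
    have aH: "a \<in> ?H" using edge_of_imp_subset[OF a(2)] by auto
    \<comment> \<open>Adding the two normals cancels \<open>w\<close>, so \<open>a = b\<close>
      forces \<open>k = - m\<close>. The normals are then opposite, and \<open>X\<close> is squeezed
      onto one line.\<close>
    have "(m + k) * (c \<bullet> (a - v)) = (w + m *\<^sub>R c) \<bullet> (a - v) + (- w + k *\<^sub>R c) \<bullet> (a - v)"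
      by (simp add: inner_add_left algebra_simps)
    also have "\<dots> = 0" using a(3) b(3) \<open>a = b\<close> by simp
    finally have "k = - m" using cneg[OF aH a(1)] by auto
    have "(w + m *\<^sub>R c) \<bullet> y = (w + m *\<^sub>R c) \<bullet> v" if "y \<in> X" for y
    proof -
      have "y \<in> ?H" using that by (simp add: hull_inc)
      from a(4)[OF this] b(4)[OF this] show ?thesis
        by (simp add: \<open>k = - m\<close> inner_add_left inner_diff_left inner_diff_right)
    qed
    then have "X \<subseteq> {y. (w + m *\<^sub>R c) \<bullet> y = (w + m *\<^sub>R c) \<bullet> v}" by blast
    then have "aff_dim X \<le> aff_dim {y. (w + m *\<^sub>R c) \<bullet> y = (w + m *\<^sub>R c) \<bullet> v}"
      by (rule aff_dim_subset)
    moreover have "w + m *\<^sub>R c \<noteq> 0"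
    proof
      assume "w + m *\<^sub>R c = 0"
      then have "w \<bullet> (w + m *\<^sub>R c) = 0" by simp
      then show False using w0 wc by (simp add: inner_add_right)
    qed
    ultimately have "collinear X" by (simp add: collinear_aff_dim)
    then show False using ncol by simp
  qed
  then show ?thesis using that a(2) b(2) by blast
qed

text \<open>A boundary point of a full-dimensional polygon lies on a facet, which in the plane is an
  edge. Not being relatively interior to it, the point is an end of that edge, and extreme points of
  a face are extreme in the whole hull.\<close>

lemma frontier_vertex_extreme:
  fixes X :: "(real^2) set"
  assumes fin: "finite X" and ncol: "\<not> collinear X" and v: "v \<in> X" "v \<in> frontier (convex hull X)"
    and ne: "\<not> (\<exists>e. e edge_of (convex hull X) \<and> v \<in> rel_interior e)"
  shows "v extreme_point_of (convex hull X)"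
proof -
  let ?H = "convex hull X"
  have "aff_dim ?H > 1" using ncol by (simp add: collinear_aff_dim aff_dim_convex_hull)
  then have dim: "aff_dim ?H = 2" using aff_dim_le_DIM[of ?H] by simp
  then have "affine hull ?H = UNIV" using aff_dim_eq_full[of ?H] by simp
  then have "v \<notin> rel_interior ?H"
    using v rel_interior_interior[of ?H] by (simp add: frontier_def)
  moreover have "v \<in> ?H" using v by (simp add: hull_inc)
  ultimately obtain F where F: "F facet_of ?H" "v \<in> F"
    using rel_boundary_of_polyhedron[OF polyhedron_convex_hull[OF fin]] by blast
  then have FH: "F face_of ?H" and dF: "aff_dim F = 1" using dim by (auto simp: facet_of_def)
  then have edge: "F edge_of ?H" by (simp add: edge_of_def)
  have "compact ?H" using fin by (simp add: finite_imp_compact compact_convex_hull)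
  then have "compact F" "convex F"
    using FH by (auto intro: face_of_imp_compact face_of_imp_convex)
  moreover have "collinear F" using dF by (simp add: collinear_aff_dim)
  ultimately obtain p q where pq: "F = closed_segment p q"
    using compact_convex_collinear_segment[of F] F by auto
  have "p \<noteq> q" using dF pq by auto
  then have "v \<notin> open_segment p q" using ne edge pq by (metis rel_interior_closed_segment)
  then have "v \<in> {p, q}" using F pq by (auto simp: open_segment_def)
  then have "v extreme_point_of F" unfolding pq by (simp add: extreme_point_of_segment)
  then show ?thesis using extreme_point_of_face[OF FH] by simp
qed

section \<open>Attachment probabilities\<close>

lemma cluster_inj: "cluster n x \<Longrightarrow> inj_on x {1..n}"
proof (rule inj_onI, rule ccontr)
  fix i j assume "cluster n x" "i \<in> {1..n}" "j \<in> {1..n}" "x i = x j" "i \<noteq> j"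
  then have "dist (x i) (x j) \<ge> 1" unfolding cluster_def by blast
  then show False using \<open>x i = x j\<close> by simp
qed

lemma arcs_tendsto:
  fixes X :: "(real^2) set" and v :: "real^2"
  assumes fin: "finite X"
  shows "((\<lambda>r. measure lborel {\<phi>\<in>{0..<2 * pi}. \<forall>y\<in>X - {v}. dist (r *\<^sub>R dir \<phi>) v < dist (r *\<^sub>R dir \<phi>) y})
    \<longlongrightarrow> measure lborel {\<phi>\<in>{0..<2 * pi}. dir \<phi> \<in> normal_dirs X v}) at_top"
proof -
  let ?S = "\<lambda>r. {\<phi>\<in>{0..<2 * pi}. \<forall>y\<in>X - {v}. dist (r *\<^sub>R dir \<phi>) v < dist (r *\<^sub>R dir \<phi>) y}"
  let ?N = "{\<phi>\<in>{0..<2 * pi}. dir \<phi> \<in> normal_dirs X v}"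
  \<comment> \<open>Squaring cancels the term in \<open>r\<close> squared. What remains is the
    normal cone condition with an error of order \<open>1 / r\<close>.\<close>
  have closer: "dist (r *\<^sub>R u) v < dist (r *\<^sub>R u) y \<longleftrightarrow> u \<bullet> (y - v) < (y \<bullet> y - v \<bullet> v) / (2 * r)"
    if "r > 0" for r and u y :: "real^2"
  proof -
    have "dist (r *\<^sub>R u) v < dist (r *\<^sub>R u) y \<longleftrightarrow> (norm (r *\<^sub>R u - v))\<^sup>2 < (norm (r *\<^sub>R u - y))\<^sup>2"
      by (simp add: dist_norm abs_le_square_iff[symmetric] not_le[symmetric])
    also have "\<dots> \<longleftrightarrow> 2 * r * (u \<bullet> (y - v)) < y \<bullet> y - v \<bullet> v"
      by (simp add: power2_norm_eq_inner algebra_simps inner_commute)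
    also have "\<dots> \<longleftrightarrow> u \<bullet> (y - v) < (y \<bullet> y - v \<bullet> v) / (2 * r)"
      using that by (simp add: field_simps)
    finally show ?thesis .
  qed
  have "finite (X - {v})" using fin by simp
  note [measurable (raw)] = pred_intros_finite[OF this]
  have [measurable]: "?S r \<in> sets borel" for r by measurable
  have [measurable]: "?N \<in> sets borel" unfolding normal_dirs_def mem_Collect_eq by measurable
  have "((\<lambda>r. \<integral>\<phi>. indicator (?S r) \<phi> \<partial>lborel) \<longlongrightarrow> (\<integral>\<phi>. (indicator ?N \<phi> :: real) \<partial>lborel)) at_top"
  proof (rule integral_dominated_convergence_at_top)
    show "(indicator ?N :: real \<Rightarrow> real) \<in> borel_measurable lborel"
      "(indicator (?S r) :: real \<Rightarrow> real) \<in> borel_measurable lborel" for r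
      by measurable
    show "integrable lborel (indicator {0..2 * pi} :: real \<Rightarrow> real)"
      by (rule integrable_real_indicator) auto
    show "\<forall>\<^sub>F r in at_top. AE \<phi> in lborel. norm (indicator (?S r) \<phi> :: real) \<le> indicator {0..2 * pi} \<phi>"
      by (auto simp: indicator_def intro!: always_eventually)
    \<comment> \<open>Pointwise convergence can fail only in directions orthogonal to some
      \<open>y - v\<close>, where the sign of the vanishing error decides.\<close>
    have "AE \<phi> in lborel. \<forall>y\<in>X - {v}. dir \<phi> \<bullet> (y - v) \<noteq> 0"
      using fin by (intro AE_finite_allI) (auto intro: AE_inner_dir_nonzero)
    then show "AE \<phi> in lborel. ((\<lambda>r. indicator (?S r) \<phi> :: real) \<longlongrightarrow> indicator ?N \<phi>) at_top"
    proof eventually_elim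
      case (elim \<phi>)
      have "\<forall>\<^sub>F r in at_top. dist (r *\<^sub>R dir \<phi>) v < dist (r *\<^sub>R dir \<phi>) y \<longleftrightarrow> dir \<phi> \<bullet> (y - v) < 0"
        if "y \<in> X - {v}" for y
      proof -
        have lim: "((\<lambda>r. (y \<bullet> y - v \<bullet> v) / (2 * r)) \<longlongrightarrow> 0) at_top"
          by (intro tendsto_divide_0[OF tendsto_const] filterlim_at_top_imp_at_infinity
              filterlim_tendsto_pos_mult_at_top[OF tendsto_const _ filterlim_ident]) auto
        have "dir \<phi> \<bullet> (y - v) \<noteq> 0" using elim that by blast
        then consider "dir \<phi> \<bullet> (y - v) < 0" | "dir \<phi> \<bullet> (y - v) > 0" by linarith
        then show ?thesis
        proof cases
          case 1
          show ?thesis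
            using order_tendstoD(1)[OF lim 1] eventually_gt_at_top[of 0]
            by eventually_elim (use 1 in \<open>simp add: closer\<close>)
        next
          case 2
          show ?thesis
            using order_tendstoD(2)[OF lim 2] eventually_gt_at_top[of 0]
            by eventually_elim (use 2 in \<open>simp add: closer\<close>)
        qed
      qed
      then have "\<forall>\<^sub>F r in at_top. \<forall>y\<in>X - {v}.
          dist (r *\<^sub>R dir \<phi>) v < dist (r *\<^sub>R dir \<phi>) y \<longleftrightarrow> dir \<phi> \<bullet> (y - v) < 0"
        using fin by (intro eventually_ball_finite) auto
      then have "\<forall>\<^sub>F r in at_top. (indicator (?S r) \<phi> :: real) = indicator ?N \<phi>"
        by eventually_elim (auto simp: indicator_def normal_dirs_def)
      then show ?case by (rule tendsto_eventually)
    qed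
  qed
  then show ?thesis by simp
qed

lemma measure_normal_dirs:
  fixes X :: "(real^2) set"
  assumes fin: "finite X" and v: "v \<in> X" "v \<in> frontier (convex hull X)" and X: "X \<noteq> {v}"
  shows "measure lborel {\<phi>\<in>{0..<2 * pi}. dir \<phi> \<in> normal_dirs X v} = pi - opening_angle X v"
proof -
  consider (edge) e where "e edge_of (convex hull X)" "v \<in> rel_interior e"
    | (segment) "\<not> (\<exists>e. e edge_of (convex hull X) \<and> v \<in> rel_interior e)" "collinear X"
    | (vertex) "\<not> (\<exists>e. e edge_of (convex hull X) \<and> v \<in> rel_interior e)" "\<not> collinear X"
    by blast
  then show ?thesis
  proof cases
    case edge
    then have "opening_angle X v = pi" by (auto simp: opening_angle_def)
    then show ?thesis using normal_dirs_rel_interior_edge[OF v(1) edge] by simp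
  next
    case segment
    then have "opening_angle X v = 0" unfolding opening_angle_def by simp
    moreover obtain d where d: "d \<noteq> 0" "normal_dirs X v = {u. u \<bullet> d < 0}"
      using normal_dirs_segment_end[OF fin v(1) X segment(2,1)] by blast
    \<comment> \<open>The half circle is treated as the intersection of two equal ones, at angle
      \<open>arccos 1 = 0\<close>.\<close>
    moreover have "d \<bullet> d / (norm d * norm d) = 1"
      using d(1) by (simp add: dot_square_norm power2_eq_square)
    ultimately show ?thesis using measure_two_half_circles[of d d] by simp
  next
    case vertex
    let ?H = "convex hull X"
    \<comment> \<open>The right-hand side does not mention \<open>a\<close> and \<open>b\<close>.
      All pairs of edges thus yield the same angle, which is the uniqueness needed for
      \<open>THE\<close>.\<close>
    have angle: "angle_at a v b = pi - measure lborel {\<phi>\<in>{0..<2 * pi}. dir \<phi> \<in> normal_dirs X v}"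
      if ab: "a \<noteq> b" "closed_segment v a edge_of ?H" "closed_segment v b edge_of ?H" for a b
      using normal_dirs_vertex[OF fin v(1) ab] measure_two_half_circles[of "a - v" "b - v"]
      by (simp add: angle_at_def)
    obtain a b where ab: "a \<noteq> b" "closed_segment v a edge_of ?H" "closed_segment v b edge_of ?H"
      using two_edges_at_vertex[OF fin vertex(2) frontier_vertex_extreme[OF fin vertex(2) v vertex(1)]]
      by blast
    have "(THE \<theta>. \<exists>a b. a \<noteq> b \<and> closed_segment v a edge_of ?H \<and> closed_segment v b edge_of ?H \<and>
        \<theta> = angle_at a v b) = pi - measure lborel {\<phi>\<in>{0..<2 * pi}. dir \<phi> \<in> normal_dirs X v}"
    proof (rule the_equality)
      show "\<exists>a b. a \<noteq> b \<and> closed_segment v a edge_of ?H \<and> closed_segment v b edge_of ?H \<and>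
          pi - measure lborel {\<phi>\<in>{0..<2 * pi}. dir \<phi> \<in> normal_dirs X v} = angle_at a v b"
        using ab angle[OF ab] by (intro exI[of _ a] exI[of _ b]) simp
    qed (use angle in blast)
    then show ?thesis
      unfolding opening_angle_def if_not_P[OF vertex(1)] if_not_P[OF vertex(2)] by simp
  qed
qed

text \<open>If a disk of radius \<open>e\<close> around \<open>v\<close> lies in the hull, then in
  every direction seen from \<open>v\<close> some particle is at least \<open>e\<close> ahead. For a
  distant point in that direction this particle is no farther than \<open>v\<close>.\<close>

lemma far_nearest_on_frontier:
  fixes X :: "(real^2) set"
  assumes fin: "finite X"
  shows "\<exists>R. \<forall>p. norm p \<ge> R \<longrightarrow> (\<forall>v\<in>X. (\<forall>y\<in>X - {v}. dist p v < dist p y) \<longrightarrow> v \<in> frontier (convex hull X))"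
proof -
  have ex: "\<exists>R. \<forall>p. norm p \<ge> R \<longrightarrow> (\<forall>y\<in>X - {v}. dist p v < dist p y) \<longrightarrow> v \<in> frontier (convex hull X)"
    if v: "v \<in> X" for v
  proof (cases "v \<in> interior (convex hull X)")
    case True
    then obtain e where e: "e > 0" "cball v e \<subseteq> convex hull X"
      unfolding mem_interior_cball by blast
    define M where "M = Max ((\<lambda>y. (norm (y - v))\<^sup>2) ` X)"
    have M: "(norm (y - v))\<^sup>2 \<le> M" if "y \<in> X" for y
      unfolding M_def using fin that by (intro Max_ge) auto
    \<comment> \<open>The threshold makes \<open>norm (p - v) * e\<close> at least
      \<open>\<bar>M\<bar>\<close>, so the gain from being ahead of \<open>v\<close> outweighs the
      squared offset of any particle.\<close>
    have "\<exists>y\<in>X - {v}. dist p y \<le> dist p v" if p: "norm p \<ge> norm v + \<bar>M\<bar> / e + 1" for p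
    proof -
      have "\<bar>M\<bar> / e \<ge> 0" using e by simp
      moreover have "norm (p - v) \<ge> norm p - norm v" by (rule norm_triangle_ineq2)
      ultimately have pv: "norm (p - v) \<ge> \<bar>M\<bar> / e + 1" "norm (p - v) > 0" using p by linarith+
      define u where "u = sgn (p - v)"
      have nu: "norm u = 1" using pv by (auto simp: u_def norm_sgn)
      have pu: "p - v = norm (p - v) *\<^sub>R u" using pv by (simp add: u_def sgn_div_norm)
      have "\<exists>y\<in>X. e \<le> u \<bullet> (y - v)"
      proof (rule ccontr)
        assume "\<not> ?thesis"
        \<comment> \<open>Otherwise the hull would lie in an open half-plane that misses the point
          \<open>v + e *\<^sub>R u\<close> of the disk.\<close>
        then have "X \<subseteq> {y. u \<bullet> y < u \<bullet> v + e}" by (force simp: inner_diff_right not_le)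
        then have "convex hull X \<subseteq> {y. u \<bullet> y < u \<bullet> v + e}"
          by (rule hull_minimal) (rule convex_halfspace_lt)
        moreover have "v + e *\<^sub>R u \<in> convex hull X"
          using e nu by (intro subsetD[OF e(2)]) (simp add: dist_norm)
        ultimately have "u \<bullet> (v + e *\<^sub>R u) < u \<bullet> v + e" by blast
        then show False using nu by (simp add: inner_add_right dot_square_norm)
      qed
      then obtain y where y: "y \<in> X" "e \<le> u \<bullet> (y - v)" by blast
      have "M \<le> \<bar>M\<bar>" by simp
      also have "\<dots> \<le> norm (p - v) * e" using pv e by (simp add: field_simps)
      also have "\<dots> \<le> 2 * (norm (p - v) * e)" using pv e by simp
      also have "\<dots> \<le> 2 * (norm (p - v) * (u \<bullet> (y - v)))"
        using pv y by (intro mult_left_mono) auto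
      also have "norm (p - v) * (u \<bullet> (y - v)) = (p - v) \<bullet> (y - v)"
        by (subst (2) pu) simp
      finally have "(norm (y - v))\<^sup>2 \<le> 2 * ((p - v) \<bullet> (y - v))" using M[OF y(1)] by simp
      moreover have "(norm (p - y))\<^sup>2 = (norm (p - v))\<^sup>2 - 2 * ((p - v) \<bullet> (y - v)) + (norm (y - v))\<^sup>2"
        by (simp add: power2_norm_eq_inner inner_diff_left inner_diff_right inner_commute)
      ultimately have "(norm (p - y))\<^sup>2 \<le> (norm (p - v))\<^sup>2" by simp
      then have "dist p y \<le> dist p v" by (simp add: dist_norm abs_le_square_iff[symmetric])
      moreover have "y \<noteq> v" using y e by auto
      ultimately show ?thesis using y by blast
    qed
    then show ?thesis by (intro exI[of _ "norm v + \<bar>M\<bar> / e + 1"]) (force simp: not_less[symmetric])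
  next
    case False
    moreover have "v \<in> closure (convex hull X)"
      using v by (meson closure_subset hull_inc subsetD)
    ultimately show ?thesis by (simp add: frontier_def)
  qed
  then have "\<forall>v\<in>X. \<exists>R. \<forall>p. norm p \<ge> R \<longrightarrow> (\<forall>y\<in>X - {v}. dist p v < dist p y) \<longrightarrow>
      v \<in> frontier (convex hull X)" by blast
  from bchoice[OF this] obtain R where R: "\<And>v p. v \<in> X \<Longrightarrow> norm p \<ge> R v \<Longrightarrow>
      \<forall>y\<in>X - {v}. dist p v < dist p y \<Longrightarrow> v \<in> frontier (convex hull X)"
    by blast
  \<comment> \<open>The sum of absolute values is a common bound that also makes sense for empty
    \<open>X\<close>.\<close>
  have "R v \<le> (\<Sum>w\<in>X. \<bar>R w\<bar>)" if "v \<in> X" for v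
    using member_le_sum[of v X "\<lambda>w. \<bar>R w\<bar>"] fin that by simp
  then have "R v \<le> norm p" if "v \<in> X" "(\<Sum>w\<in>X. \<bar>R w\<bar>) \<le> norm p" for v p
    using that by (blast intro: order_trans)
  then show ?thesis using R by blast
qed

lemma attaches_far_iff:
  assumes n: "n \<ge> 1" and inj: "inj_on x {1..n}" and k: "k \<in> {1..n}"
    and far: "\<And>i. i \<in> {1..n} \<Longrightarrow> dist p (x i) > 1"
  shows "attaches n x p k \<longleftrightarrow> (\<forall>y\<in>x ` {1..n} - {x k}. dist p (x k) < dist p y)"
proof -
  have "attaches n x p k \<longleftrightarrow> p \<in> cell n x k"
    using attaches_iff[OF n inj k, of p] far[OF k] by auto
  also have "\<dots> \<longleftrightarrow> (\<forall>j\<in>{1..n} - {k}. dist p (x k) < dist p (x j))"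
    using far[OF k] by (auto simp: cell_def)
  also have "\<dots> \<longleftrightarrow> (\<forall>y\<in>x ` ({1..n} - {k}). dist p (x k) < dist p y)" by simp
  also have "x ` ({1..n} - {k}) = x ` {1..n} - {x k}"
    using inj_on_image_set_diff[OF inj, of "{1..n}" "{k}"] k by auto
  finally show ?thesis .
qed

lemma borel_attaches:
  assumes n: "n \<ge> 1" and inj: "inj_on x {1..n}" and k: "k \<in> {1..n}"
  shows "{p. attaches n x p k} \<in> sets borel"
proof -
  have [measurable]: "cell n x i \<in> sets borel" for i using open_cell by (rule borel_open)
  have "{p. attaches n x p k} = ((\<Union>i\<in>{1..n}. cell n x i) \<inter> {p. dist p (x k) = 1}) \<union>
      (cell n x k \<inter> {p. dist p (x k) > 1})"
    using attaches_iff[OF n inj k] by auto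
  also have "\<dots> \<in> sets borel" by measurable
  finally show ?thesis .
qed

lemma measure_uniform_circle:
  assumes [measurable]: "A \<in> sets borel"
  shows "measure (uniform_circle r) A = measure lborel {\<phi>\<in>{0..<2 * pi}. r *\<^sub>R dir \<phi> \<in> A} / (2 * pi)"
proof -
  have vec: "vector [r * cos \<phi>, r * sin \<phi>] = r *\<^sub>R dir \<phi>" for \<phi>
    by (simp add: dir_def vec_eq_iff forall_2)
  have "measure (uniform_circle r) A = measure (uniform_measure lborel {0..<2 * pi}) {\<phi>. r *\<^sub>R dir \<phi> \<in> A}"
    unfolding uniform_circle_def vec by (subst measure_distr) (auto simp: vimage_def)
  also have "\<dots> = measure lborel ({0..<2 * pi} \<inter> {\<phi>. r *\<^sub>R dir \<phi> \<in> A}) / measure lborel {0..<2 * pi}"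
    by (rule measure_uniform_measure) auto
  also have "{0..<2 * pi} \<inter> {\<phi>. r *\<^sub>R dir \<phi> \<in> A} = {\<phi>\<in>{0..<2 * pi}. r *\<^sub>R dir \<phi> \<in> A}" by auto
  finally show ?thesis by simp
qed

theorem mainTheorem5:
  fixes n :: nat and x :: "nat \<Rightarrow> real^2"
  assumes "n \<ge> 2" and "cluster n x"
  shows "(\<exists>R. \<forall>r\<ge>R. \<forall>p. norm p = r \<longrightarrow>
            (\<forall>k. attaches n x p k \<longrightarrow> x k \<in> frontier (cluster_hull n x))) \<and>
         (\<forall>k\<in>{1..n}. x k \<in> frontier (cluster_hull n x) \<longrightarrow>
            ((\<lambda>r. measure (uniform_circle r) {p. attaches n x p k})
               \<longlongrightarrow> (pi - opening_angle (x ` {1..n}) (x k)) / (2 * pi)) at_top)"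
proof -
  let ?X = "x ` {1..n}"
  have n: "n \<ge> 1" using assms by simp
  have inj: "inj_on x {1..n}" using assms cluster_inj by blast
  have fin: "finite ?X" by simp
  obtain B where "\<And>y. y \<in> ?X \<Longrightarrow> norm y \<le> B"
    using finite_imp_bounded[OF fin] unfolding bounded_iff by blast
  \<comment> \<open>At norm \<open>B + 2\<close> every particle is at distance at least 2, so no
    starting point touches the cluster and only the nearest-particle case of attachment
    remains.\<close>
  then have far: "dist p (x i) > 1" if "i \<in> {1..n}" "norm p \<ge> B + 2" for i p
    using that norm_triangle_ineq2[of p "x i"] by (force simp: dist_norm)
  have attach: "attaches n x p k \<longleftrightarrow> (\<forall>y\<in>?X - {x k}. dist p (x k) < dist p y)"
    if "k \<in> {1..n}" "norm p \<ge> B + 2" for k p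
    using attaches_far_iff[OF n inj that(1) far] that by blast
  obtain R where R: "\<And>p v. norm p \<ge> R \<Longrightarrow> v \<in> ?X \<Longrightarrow> \<forall>y\<in>?X - {v}. dist p v < dist p y \<Longrightarrow>
      v \<in> frontier (cluster_hull n x)"
    using far_nearest_on_frontier[OF fin] by blast
  show ?thesis
  proof (intro conjI ballI impI)
    show "\<exists>R. \<forall>r\<ge>R. \<forall>p. norm p = r \<longrightarrow>
        (\<forall>k. attaches n x p k \<longrightarrow> x k \<in> frontier (cluster_hull n x))"
    proof (intro exI[of _ "max R (B + 2)"] allI impI)
      fix r p k assume r: "max R (B + 2) \<le> r" "norm p = r" and att: "attaches n x p k"
      then have k: "k \<in> {1..n}" by (simp add: attaches_def)
      then show "x k \<in> frontier (cluster_hull n x)"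
        using R[of p "x k"] attach[of k p] att r by auto
    qed
  next
    fix k assume k: "k \<in> {1..n}" and fr: "x k \<in> frontier (cluster_hull n x)"
    \<comment> \<open>Here \<open>n \<ge> 2\<close> enters: a second particle is needed for the hull
      to have an edge at \<open>x k\<close>.\<close>
    have "card ?X = n" using inj by (simp add: card_image)
    then have "?X \<noteq> {x k}" using assms(1) by auto
    then have angle: "measure lborel {\<phi>\<in>{0..<2 * pi}. dir \<phi> \<in> normal_dirs ?X (x k)} = pi - opening_angle ?X (x k)"
      using measure_normal_dirs[OF fin _ fr] k by blast
    have "((\<lambda>r. measure lborel {\<phi>\<in>{0..<2 * pi}. \<forall>y\<in>?X - {x k}. dist (r *\<^sub>R dir \<phi>) (x k) < dist (r *\<^sub>R dir \<phi>) y} / (2 * pi))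
        \<longlongrightarrow> (pi - opening_angle ?X (x k)) / (2 * pi)) at_top"
      by (intro tendsto_divide tendsto_const arcs_tendsto[OF fin, of "x k", unfolded angle]) simp
    moreover have "\<forall>\<^sub>F r in at_top. measure lborel {\<phi>\<in>{0..<2 * pi}. \<forall>y\<in>?X - {x k}. dist (r *\<^sub>R dir \<phi>) (x k) < dist (r *\<^sub>R dir \<phi>) y} / (2 * pi)
        = measure (uniform_circle r) {p. attaches n x p k}"
      \<comment> \<open>Nonnegativity of \<open>r\<close> ensures that
        \<open>r *\<^sub>R dir \<phi>\<close> has norm \<open>r\<close>.\<close>
      using eventually_ge_at_top[of "max 0 (B + 2)"]
    proof eventually_elim
      case (elim r)
      then have "attaches n x (r *\<^sub>R dir \<phi>) k \<longleftrightarrow> (\<forall>y\<in>?X - {x k}. dist (r *\<^sub>R dir \<phi>) (x k) < dist (r *\<^sub>R dir \<phi>) y)" for \<phi>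
        by (intro attach[OF k]) simp
      then show ?case by (simp add: measure_uniform_circle[OF borel_attaches[OF n inj k]])
    qed
    ultimately show "((\<lambda>r. measure (uniform_circle r) {p. attaches n x p k})
        \<longlongrightarrow> (pi - opening_angle ?X (x k)) / (2 * pi)) at_top"
      by (rule Lim_transform_eventually)
  qed
qed

end
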